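(* Write $\mathbf{T}(\text{first column},\text{first row})$ for the $n\times n$ Toeplitz matrix with the given first column and first row, and $\mathbf{H}(\text{first column},\text{last row})$ for the $n\times n$ Hankel matrix with the given first column and last row. Set $$\begin{aligned} \mathbf{T}^0&=\mathbf{T}([f_0,f_1,f_2,\ldots,f_{n-1}],[f_0,f_1,f_2,\ldots,f_{n-1}]),\\ \mathbf{T}^+&=\mathbf{T}([f_1,f_2,f_3,\ldots,f_n],[f_1,f_0,f_1,\ldots,f_{n-2}]),\\ \mathbf{T}^-&=\mathbf{T}([f_1,f_0,f_1,\ldots,f_{n-2}],[f_1,f_2,f_3,\ldots,f_n]),\\ \mathbf{H}^0&=\mathbf{H}([f_0,f_1,f_2,\ldots,f_{n-1}],[f_{n-1},f_n,f_{n+1},\ldots,f_{2n-2}]),\\ \mathbf{H}^+&=\mathbf{H}([f_1,f_2,f_3,\ldots,f_n],[f_n,f_{n+1},f_{n+2},\ldots,f_{2n-1}]),\\ \mathbf{H}^-&=\mathbf{H}([f_1,f_0,f_1,\ldots,f_{n-2}],[f_{n-2},f_{n-1},f_n,\ldots,f_{2n-3}]). \end{aligned}$$ Then $$U^*PU=\tfrac14\left(\mathbf{T}^++\mathbf{T}^-+\mathbf{H}^++\mathbf{H}^-\right)\qquad\text{and}\qquad U^*U=\tfrac12\left(\mathbf{T}^0+\mathbf{H}^0\right).$$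
   Context: Let $x_{\max}>0$ and let $v$ be a sufficiently regular positive function on $[0,x_{\max}]$. Let $A=-v^2\frac{d^2}{dx^2}$ with boundary conditions $u_x|_{x=0}=0$, $u|_{x=x_{\max}}=0$; it is self-adjoint and positive definite for $\langle\langle u,w\rangle\rangle=\int_0^{x_{\max}}u(x)w(x)\frac{1}{v^2(x)}\,dx$. Let $\delta(x+0)$ be the right-half Dirac delta ($\int_0^\infty\delta(x+0)\,dx=1$). Let $q\in L_1(\mathbb{R})$ be an even, sufficiently smooth approximation of $\delta(t)$ with nonnegative Fourier transform $\widetilde q(s^2)=\int_0^\infty2\cos(ts)q(t)\,dt$ and with $\widetilde q(A)$ positive definite (e.g. $\widetilde q(s^2)=e^{-\sigma^2s^2/2}$, $\sigma>0$). Put $b=v(0)\,\widetilde q(A)^{1/2}\delta(x+0)$. Fix $\tau>0$ and $n\in\mathbb{N}$. The propagator is $P=\cos(\tau\sqrt A)$, and the snapshots are $u_k=\cos(k\tau\sqrt A)b=T_k(P)b$, $k=0,\ldots,2n-1$ ($T_k$: Chebyshev polynomials of the first kind). The data are $f_k=\langle\langle u_0,u_k\rangle\rangle$, $k=0,\ldots,2n-1$. $U=[u_0,\ldots,u_{n-1}]$, and $U^*U$, $U^*PU$ are the $n\times n$ matrices with entries $\langle\langle u_{i-1},u_{j-1}\rangle\rangle$ and $\langle\langle u_{i-1},Pu_{j-1}\rangle\rangle$. *)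

theory Defs
  imports "HOL-Analysis.Analysis" "Jordan_Normal_Form.Matrix"
begin

text \<open>
  The Hilbert space is the real space $L_2([0,x_{max}])$ with weight $1/v^2$. Its elements are
  represented by functions \<open>real \<Rightarrow> real\<close>, of which only the values on \<open>{0..xmax}\<close>, up to null
  sets, matter.
\<close>

definition wip :: "(real \<Rightarrow> real) \<Rightarrow> real \<Rightarrow> (real \<Rightarrow> real) \<Rightarrow> (real \<Rightarrow> real) \<Rightarrow> real" where
  "wip v xmax u w = (LINT x:{0..xmax}|lborel. u x * w x * (1 / (v x)\<^sup>2))"

definition L2w :: "(real \<Rightarrow> real) \<Rightarrow> real \<Rightarrow> (real \<Rightarrow> real) set" where
  "L2w v xmax = {u. set_borel_measurable lborel {0..xmax} u \<and>
     set_integrable lborel {0..xmax} (\<lambda>x. (u x)\<^sup>2 * (1 / (v x)\<^sup>2))}"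

text \<open>
  The graph of $A = -v^2 d^2/dx^2$ on its self-adjointness domain: $u$ is $C^1$ on $[0,x_{max}]$,
  $u_x$ is absolutely continuous with $u_{xx}$ in $L_2$, and $u_x(0) = 0$, $u(x_{max}) = 0$.
\<close>

definition A_graph ::
  "(real \<Rightarrow> real) \<Rightarrow> real \<Rightarrow> (real \<Rightarrow> real) \<Rightarrow> (real \<Rightarrow> real) \<Rightarrow> bool" where
  "A_graph v xmax u w \<longleftrightarrow> (\<exists>u\<^sub>x u\<^sub>x\<^sub>x.
     (\<forall>x\<in>{0..xmax}. (u has_real_derivative u\<^sub>x x) (at x within {0..xmax})) \<and>
     u\<^sub>x\<^sub>x \<in> L2w v xmax \<and>
     (\<forall>x\<in>{0..xmax}. u\<^sub>x x = u\<^sub>x 0 + (LINT t:{0..x}|lborel. u\<^sub>x\<^sub>x t)) \<and>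
     u\<^sub>x 0 = 0 \<and> u xmax = 0 \<and>
     (AE x in lborel. x \<in> {0..xmax} \<longrightarrow> w x = - (v x)\<^sup>2 * u\<^sub>x\<^sub>x x))"

definition normalized_eigenfunction ::
  "(real \<Rightarrow> real) \<Rightarrow> real \<Rightarrow> real \<Rightarrow> (real \<Rightarrow> real) \<Rightarrow> bool" where
  "normalized_eigenfunction v xmax l \<phi> \<longleftrightarrow>
     A_graph v xmax \<phi> (\<lambda>x. l * \<phi> x) \<and> wip v xmax \<phi> \<phi> = 1"

definition A_spectrum :: "(real \<Rightarrow> real) \<Rightarrow> real \<Rightarrow> real set" where
  "A_spectrum v xmax = {l. \<exists>\<phi>. normalized_eigenfunction v xmax l \<phi>}"

text \<open>
  All eigenvalues are simple, since the initial condition $u_x(0) = 0$ determines a solution of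
  $-v^2 u_{xx} = l u$ up to a scalar. Hence the choice below is unique on \<open>{0..xmax}\<close> up to sign.
\<close>

definition A_eigenfunction :: "(real \<Rightarrow> real) \<Rightarrow> real \<Rightarrow> real \<Rightarrow> real \<Rightarrow> real" where
  "A_eigenfunction v xmax l = (SOME \<phi>. normalized_eigenfunction v xmax l \<phi>)"

text \<open>
  Functional calculus. $A$ is a regular Sturm-Liouville operator, so its spectrum consists of
  eigenvalues and the normalized eigenfunctions form an orthonormal basis; $g(A)$ is the operator
  $z \mapsto \sum_l g(l) \langle\langle z,\phi_l \rangle\rangle \phi_l$ with convergence in the
  weighted $L_2$ norm. The vector $z$ is passed as the functional
  \<open>z w = \<langle>\<langle>z,w\<rangle>\<rangle>\<close>, so that $z$ may also be a distribution that pairs with the eigenfunctions.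
\<close>

definition fun_of_A ::
  "(real \<Rightarrow> real) \<Rightarrow> real \<Rightarrow> (real \<Rightarrow> real) \<Rightarrow> ((real \<Rightarrow> real) \<Rightarrow> real) \<Rightarrow> real \<Rightarrow> real" where
  "fun_of_A v xmax g z = (SOME u. u \<in> L2w v xmax \<and>
     ((\<lambda>F. let r = (\<lambda>x. u x - (\<Sum>l\<in>F. g l * z (A_eigenfunction v xmax l)
                                   * A_eigenfunction v xmax l x))
            in wip v xmax r r) \<longlongrightarrow> 0) (finite_subsets_at_top (A_spectrum v xmax)))"

definition op_of_A ::
  "(real \<Rightarrow> real) \<Rightarrow> real \<Rightarrow> (real \<Rightarrow> real) \<Rightarrow> (real \<Rightarrow> real) \<Rightarrow> real \<Rightarrow> real" where
  "op_of_A v xmax g u = fun_of_A v xmax g (wip v xmax u)"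

definition positive_definite_op ::
  "(real \<Rightarrow> real) \<Rightarrow> real \<Rightarrow> ((real \<Rightarrow> real) \<Rightarrow> real \<Rightarrow> real) \<Rightarrow> bool" where
  "positive_definite_op v xmax T \<longleftrightarrow>
     (\<forall>u\<in>L2w v xmax. \<not> (AE x in lborel. x \<in> {0..xmax} \<longrightarrow> u x = 0) \<longrightarrow> 0 < wip v xmax u (T u))"

text \<open>
  The pairing of $\delta(x+0)$ with a continuous function on \<open>{0..}\<close>: the whole unit mass counts.
\<close>

definition dirac_right :: "(real \<Rightarrow> real) \<Rightarrow> real" where
  "dirac_right w = w 0"

definition dirac_wip :: "(real \<Rightarrow> real) \<Rightarrow> (real \<Rightarrow> real) \<Rightarrow> real" where
  "dirac_wip v w = dirac_right (\<lambda>x. w x * (1 / (v x)\<^sup>2))"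

text \<open>As a function of $\mu = s^2$.\<close>

definition qtilde :: "(real \<Rightarrow> real) \<Rightarrow> real \<Rightarrow> real" where
  "qtilde q \<mu> = (LINT t:{0..}|lborel. 2 * cos (t * sqrt \<mu>) * q t)"

definition source :: "(real \<Rightarrow> real) \<Rightarrow> real \<Rightarrow> (real \<Rightarrow> real) \<Rightarrow> real \<Rightarrow> real" where
  "source v xmax q =
     (\<lambda>x. v 0 * fun_of_A v xmax (\<lambda>l. sqrt (qtilde q l)) (dirac_wip v) x)"

definition propagator ::
  "(real \<Rightarrow> real) \<Rightarrow> real \<Rightarrow> real \<Rightarrow> (real \<Rightarrow> real) \<Rightarrow> real \<Rightarrow> real" where
  "propagator v xmax \<tau> = op_of_A v xmax (\<lambda>l. cos (\<tau> * sqrt l))"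

definition snapshot ::
  "(real \<Rightarrow> real) \<Rightarrow> real \<Rightarrow> (real \<Rightarrow> real) \<Rightarrow> real \<Rightarrow> nat \<Rightarrow> real \<Rightarrow> real" where
  "snapshot v xmax q \<tau> k = op_of_A v xmax (\<lambda>l. cos (real k * \<tau> * sqrt l)) (source v xmax q)"

definition data ::
  "(real \<Rightarrow> real) \<Rightarrow> real \<Rightarrow> (real \<Rightarrow> real) \<Rightarrow> real \<Rightarrow> nat \<Rightarrow> real" where
  "data v xmax q \<tau> k = wip v xmax (snapshot v xmax q \<tau> 0) (snapshot v xmax q \<tau> k)"

text \<open>
  $U = [u_0,\ldots,u_{n-1}]$ is a list of functions (its columns), and \<open>adj_times\<close> is the
  product $U^* W$ of two such lists.
\<close>

definition snapshots ::
  "(real \<Rightarrow> real) \<Rightarrow> real \<Rightarrow> (real \<Rightarrow> real) \<Rightarrow> real \<Rightarrow> nat \<Rightarrow> (real \<Rightarrow> real) list" where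
  "snapshots v xmax q \<tau> n = map (snapshot v xmax q \<tau>) [0..<n]"

definition adj_times ::
  "(real \<Rightarrow> real) \<Rightarrow> real \<Rightarrow> (real \<Rightarrow> real) list \<Rightarrow> (real \<Rightarrow> real) list \<Rightarrow> real mat" where
  "adj_times v xmax U W = mat (length U) (length W) (\<lambda>(i, j). wip v xmax (U ! i) (W ! j))"

definition toeplitz :: "nat \<Rightarrow> real list \<Rightarrow> real list \<Rightarrow> real mat" where
  "toeplitz n c r = mat n n (\<lambda>(i, j). if j \<le> i then c ! (i - j) else r ! (j - i))"

definition hankel :: "nat \<Rightarrow> real list \<Rightarrow> real list \<Rightarrow> real mat" where
  "hankel n c r = mat n n (\<lambda>(i, j). if i + j < n then c ! (i + j) else r ! (i + j - (n - 1)))"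

definition T0 :: "nat \<Rightarrow> (nat \<Rightarrow> real) \<Rightarrow> real mat" where
  "T0 n f = toeplitz n (map f [0..<n]) (map f [0..<n])"

definition Tplus :: "nat \<Rightarrow> (nat \<Rightarrow> real) \<Rightarrow> real mat" where
  "Tplus n f = toeplitz n (map f [1..<n + 1]) (f 1 # map f [0..<n - 1])"

definition Tminus :: "nat \<Rightarrow> (nat \<Rightarrow> real) \<Rightarrow> real mat" where
  "Tminus n f = toeplitz n (f 1 # map f [0..<n - 1]) (map f [1..<n + 1])"

definition H0 :: "nat \<Rightarrow> (nat \<Rightarrow> real) \<Rightarrow> real mat" where
  "H0 n f = hankel n (map f [0..<n]) (map f [n - 1..<2 * n - 1])"

definition Hplus :: "nat \<Rightarrow> (nat \<Rightarrow> real) \<Rightarrow> real mat" where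
  "Hplus n f = hankel n (map f [1..<n + 1]) (map f [n..<2 * n])"

text \<open>
  The integer range in the last row only matters for \<open>n = 1\<close>, where $f_{n-2}$ is read as
  $f_{-1} = f_1$, in agreement with the first column.
\<close>

definition Hminus :: "nat \<Rightarrow> (nat \<Rightarrow> real) \<Rightarrow> real mat" where
  "Hminus n f = hankel n (f 1 # map f [0..<n - 1])
     (map (\<lambda>k. f (nat \<bar>k\<bar>)) [int n - 2..2 * int n - 3])"

end

theory Submission
  imports Defs
begin

text \<open>
  In the orthonormal system of eigenfunctions \<open>\<phi>\<^sub>l\<close> of \<open>A\<close> everything is diagonal. If
  \<open>\<beta>\<^sub>l = \<langle>\<langle>b, \<phi>\<^sub>l\<rangle>\<rangle>\<close>, the snapshot \<open>u\<^sub>k\<close> has the coefficients \<open>cos (k \<theta>\<^sub>l) \<beta>\<^sub>l\<close> with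
  \<open>\<theta>\<^sub>l = \<tau> sqrt l\<close>, and the propagator multiplies coefficients by \<open>cos \<theta>\<^sub>l\<close>. Parseval's identity
  turns each inner product into a series; in particular \<open>f\<^sub>k = \<Sum>\<^sub>l \<beta>\<^sub>l\<^sup>2 cos (k \<theta>\<^sub>l)\<close>, which makes sense
  for every integer \<open>k\<close> and is even in \<open>k\<close>. Applied termwise, the product formulas for the cosine give
  \<open>\<langle>\<langle>u\<^sub>i, u\<^sub>j\<rangle>\<rangle>\<close> as the mean of \<open>f\<close> at \<open>i - j\<close> and \<open>i + j\<close>, and \<open>\<langle>\<langle>u\<^sub>i, P u\<^sub>j\<rangle>\<rangle>\<close> as the mean of \<open>f\<close> at the
  four integers obtained from these two by adding or subtracting 1. The terms that depend on \<open>i - j\<close>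
  form the Toeplitz matrices and those that depend on \<open>i + j\<close> the Hankel matrices.

  The analytic content is that the functional calculus is meaningful on the vectors involved: an
  operator \<open>g(A)\<close> is a choice of a limit in \<open>L\<^sub>2\<close>, about which nothing is known unless the limit
  exists. The lemma \<open>Riesz_Fischer\<close> reduces existence to square summability of the coefficients. For the
  snapshots this is Bessel's inequality, once the source \<open>b\<close> is in \<open>L\<^sub>2\<close>. For the source itself the
  coefficients are \<open>sqrt (qtilde l) \<phi>\<^sub>l(0)\<close> up to a constant, and two facts combine: \<open>qtilde l\<close> is
  \<open>O(1/l)\<close>, by two integrations by parts (\<open>qtilde_decay\<close>), and \<open>\<Sum>\<^sub>l \<phi>\<^sub>l(0)\<^sup>2 / l\<close> is finite
  (\<open>summable_ef_at_0\<close>), because the derivatives \<open>\<phi>\<^sub>l'\<close>, divided by \<open>sqrt l\<close>, are orthonormal in the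
  unweighted \<open>L\<^sub>2\<close> and \<open>- \<phi>\<^sub>l(0)\<close> is the integral of \<open>\<phi>\<^sub>l'\<close>.
\<close>

section \<open>Square-integrable functions on a measure\<close>

definition sq_integrable :: "'a measure \<Rightarrow> ('a \<Rightarrow> real) \<Rightarrow> bool" where
  "sq_integrable M u \<longleftrightarrow> u \<in> borel_measurable M \<and> integrable M (\<lambda>x. (u x)\<^sup>2)"

definition ip :: "'a measure \<Rightarrow> ('a \<Rightarrow> real) \<Rightarrow> ('a \<Rightarrow> real) \<Rightarrow> real" where
  "ip M u w = (\<integral>x. u x * w x \<partial>M)"

lemma sq_integrable_measurable [measurable_dest]: "sq_integrable M u \<Longrightarrow> u \<in> borel_measurable M"
  by (simp add: sq_integrable_def)

lemma sq_integrable_integrable_mult: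
  assumes u: "sq_integrable M u" and w: "sq_integrable M w"
  shows "integrable M (\<lambda>x. u x * w x)"
proof (rule Bochner_Integration.integrable_bound)
  show "integrable M (\<lambda>x. (u x)\<^sup>2 + (w x)\<^sup>2)"
    using u w by (simp add: sq_integrable_def)
  show "(\<lambda>x. u x * w x) \<in> borel_measurable M"
    using u w by measurable
  have "\<bar>a * b\<bar> \<le> a\<^sup>2 + b\<^sup>2" for a b :: real
  proof -
    have "2 * (\<bar>a\<bar> * \<bar>b\<bar>) \<le> a\<^sup>2 + b\<^sup>2"
      using sum_squares_bound[of "\<bar>a\<bar>" "\<bar>b\<bar>"] by (simp only: power2_abs mult.assoc)
    moreover have "0 \<le> \<bar>a\<bar> * \<bar>b\<bar>"
      by simp
    ultimately show ?thesis
      unfolding abs_mult by linarith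
  qed
  then show "AE x in M. norm (u x * w x) \<le> norm ((u x)\<^sup>2 + (w x)\<^sup>2)"
    by simp
qed

lemma sq_integrable_add:
  assumes "sq_integrable M u" "sq_integrable M w"
  shows "sq_integrable M (\<lambda>x. u x + w x)"
  using assms sq_integrable_integrable_mult[OF assms]
  by (auto simp: sq_integrable_def power2_sum mult.assoc)

lemma sq_integrable_cmult: "sq_integrable M u \<Longrightarrow> sq_integrable M (\<lambda>x. c * u x)"
  by (auto simp: sq_integrable_def power_mult_distrib)

lemma sq_integrable_diff:
  assumes "sq_integrable M u" "sq_integrable M w"
  shows "sq_integrable M (\<lambda>x. u x - w x)"
  using sq_integrable_add[OF assms(1) sq_integrable_cmult[OF assms(2), of "-1"]] by simp

lemma sq_integrable_sum:
  "(\<And>l. l \<in> F \<Longrightarrow> sq_integrable M (e l)) \<Longrightarrow> sq_integrable M (\<lambda>x. \<Sum>l\<in>F. c l * e l x)"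
proof (induction F rule: infinite_finite_induct)
  case (insert l F)
  then show ?case
    by (simp add: sq_integrable_add sq_integrable_cmult)
qed (simp_all add: sq_integrable_def)

lemma ip_commute: "ip M u w = ip M w u"
  by (simp add: ip_def mult.commute)

lemma ip_self_nonneg: "0 \<le> ip M u u"
  by (simp add: ip_def)

lemma ip_diff_left:
  assumes "sq_integrable M u" "sq_integrable M w" "sq_integrable M z"
  shows "ip M (\<lambda>x. u x - w x) z = ip M u z - ip M w z"
  using assms by (simp add: ip_def left_diff_distrib sq_integrable_integrable_mult)

lemma ip_diff_right:
  assumes "sq_integrable M u" "sq_integrable M w" "sq_integrable M z"
  shows "ip M z (\<lambda>x. u x - w x) = ip M z u - ip M z w"
  using ip_diff_left[OF assms] by (simp add: ip_commute)

lemma ip_cmult_left: "ip M (\<lambda>x. c * u x) w = c * ip M u w"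
  by (simp add: ip_def mult.assoc)

lemma ip_cmult_right: "ip M w (\<lambda>x. c * u x) = c * ip M w u"
  by (simp add: ip_commute[of M w] ip_cmult_left)

lemma ip_sum_left:
  assumes "\<And>l. l \<in> F \<Longrightarrow> sq_integrable M (e l)" "sq_integrable M w"
  shows "ip M (\<lambda>x. \<Sum>l\<in>F. c l * e l x) w = (\<Sum>l\<in>F. c l * ip M (e l) w)"
  using assms
  by (simp add: ip_def sum_distrib_right mult.assoc sq_integrable_integrable_mult)

lemma ip_diff_self:
  assumes "sq_integrable M u" "sq_integrable M w"
  shows "ip M (\<lambda>x. u x - w x) (\<lambda>x. u x - w x) = ip M u u - 2 * ip M u w + ip M w w"
  using assms
  by (simp add: ip_diff_left ip_diff_right sq_integrable_diff ip_commute[of M w u])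

text \<open>
  The quadratic is the square norm of \<open>u - t w\<close>.
\<close>

lemma ip_quadratic_nonneg:
  assumes u: "sq_integrable M u" and w: "sq_integrable M w"
  shows "0 \<le> ip M u u - 2 * t * ip M u w + t\<^sup>2 * ip M w w"
proof -
  have "0 \<le> ip M (\<lambda>x. u x - t * w x) (\<lambda>x. u x - t * w x)"
    by (rule ip_self_nonneg)
  also have "\<dots> = ip M u u - 2 * t * ip M u w + t\<^sup>2 * ip M w w"
    by (subst ip_diff_self[OF u sq_integrable_cmult[OF w]])
       (simp add: ip_cmult_left ip_cmult_right power2_eq_square)
  finally show ?thesis .
qed

lemma ip_diff_self_le:
  assumes "sq_integrable M u" "sq_integrable M w"
  shows "ip M (\<lambda>x. u x - w x) (\<lambda>x. u x - w x) \<le> 2 * ip M u u + 2 * ip M w w"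
  using ip_quadratic_nonneg[OF assms, of "-1"] by (simp add: ip_diff_self[OF assms])

lemma ip_Cauchy_Schwarz:
  assumes u: "sq_integrable M u" and w: "sq_integrable M w"
  shows "(ip M u w)\<^sup>2 \<le> ip M u u * ip M w w"
proof -
  let ?A = "ip M u u" and ?B = "ip M w w" and ?a = "ip M u w"
  note * = ip_quadratic_nonneg[OF u w]
  show ?thesis
  proof (cases "?B = 0")
    case True
    have "?a = 0"
    proof (rule ccontr)
      assume "?a \<noteq> 0"
      then show False
        using *[of "(?A + 1) / (2 * ?a)"] True by simp
    qed
    then show ?thesis using True by simp
  next
    case False
    then have B: "0 < ?B"
      using ip_self_nonneg[of M w] by simp
    have "0 \<le> ?B * (?A - 2 * (?a / ?B) * ?a + (?a / ?B)\<^sup>2 * ?B)"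
      using *[of "?a / ?B"] B by simp
    also have "\<dots> = ?A * ?B - ?a\<^sup>2"
      using B by (simp add: field_simps power2_eq_square)
    finally show ?thesis by simp
  qed
qed

section \<open>Orthonormal expansions\<close>

definition orthonormal_on :: "'a measure \<Rightarrow> 'i set \<Rightarrow> ('i \<Rightarrow> 'a \<Rightarrow> real) \<Rightarrow> bool" where
  "orthonormal_on M S e \<longleftrightarrow> (\<forall>l\<in>S. sq_integrable M (e l)) \<and>
     (\<forall>l\<in>S. \<forall>m\<in>S. ip M (e l) (e m) = of_bool (l = m))"

text \<open>
  The limit along the finite subsets of \<open>S\<close> is unconditional convergence; it makes sense for index
  sets of any cardinality, such as a spectrum given only as a set of reals.
\<close>

definition expands ::
  "'a measure \<Rightarrow> 'i set \<Rightarrow> ('i \<Rightarrow> 'a \<Rightarrow> real) \<Rightarrow> ('i \<Rightarrow> real) \<Rightarrow> ('a \<Rightarrow> real) \<Rightarrow> bool" where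
  "expands M S e c u \<longleftrightarrow> sq_integrable M u \<and>
     ((\<lambda>F. let r = (\<lambda>x. u x - (\<Sum>l\<in>F. c l * e l x)) in ip M r r) \<longlongrightarrow> 0) (finite_subsets_at_top S)"

lemma expands_cong:
  assumes "\<And>l. l \<in> S \<Longrightarrow> c l = d l"
  shows "expands M S e c u \<longleftrightarrow> expands M S e d u"
proof -
  have "(\<Sum>l\<in>F. c l * e l x) = (\<Sum>l\<in>F. d l * e l x)" if "F \<subseteq> S" for F x
    using assms that by (intro sum.cong) auto
  then have "\<forall>\<^sub>F F in finite_subsets_at_top S.
      (let r = (\<lambda>x. u x - (\<Sum>l\<in>F. c l * e l x)) in ip M r r)
    = (let r = (\<lambda>x. u x - (\<Sum>l\<in>F. d l * e l x)) in ip M r r)"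
    by (intro eventually_finite_subsets_at_top_weakI) simp
  from tendsto_cong[OF this] show ?thesis
    by (simp add: expands_def)
qed

lemma ip_orthonormal_sum_left:
  assumes e: "orthonormal_on M S e" and F: "finite F" "F \<subseteq> S" and m: "m \<in> S"
  shows "ip M (\<lambda>x. \<Sum>l\<in>F. c l * e l x) (e m) = (if m \<in> F then c m else 0)"
proof -
  have "ip M (\<lambda>x. \<Sum>l\<in>F. c l * e l x) (e m) = (\<Sum>l\<in>F. c l * ip M (e l) (e m))"
    using e F m by (intro ip_sum_left) (auto simp: orthonormal_on_def)
  also have "\<dots> = (\<Sum>l\<in>F. if m = l then c l else 0)"
    using e F m by (intro sum.cong) (auto simp: orthonormal_on_def subset_iff)
  also have "\<dots> = (if m \<in> F then c m else 0)"
    using F by (simp add: sum.delta')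
  finally show ?thesis .
qed

lemma ip_orthonormal_sum_self:
  assumes e: "orthonormal_on M S e" and F: "finite F" "F \<subseteq> S"
  shows "ip M (\<lambda>x. \<Sum>l\<in>F. c l * e l x) (\<lambda>x. \<Sum>l\<in>F. c l * e l x) = (\<Sum>l\<in>F. (c l)\<^sup>2)"
proof -
  let ?p = "\<lambda>x. \<Sum>l\<in>F. c l * e l x"
  have *: "sq_integrable M (e l)" if "l \<in> F" for l
    using e F that by (auto simp: orthonormal_on_def)
  have "ip M ?p ?p = (\<Sum>l\<in>F. c l * ip M (e l) ?p)"
    by (intro ip_sum_left sq_integrable_sum *)
  also have "\<dots> = (\<Sum>l\<in>F. c l * c l)"
    using F by (intro sum.cong refl)
      (auto simp: ip_commute[of M "e _"] ip_orthonormal_sum_left[OF e F] subset_iff)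
  finally show ?thesis by (simp add: power2_eq_square)
qed

lemma Bessel_inequality:
  assumes e: "orthonormal_on M S e" and u: "sq_integrable M u"
  shows "(\<lambda>l. (ip M u (e l))\<^sup>2) summable_on S"
proof (rule nonneg_bdd_above_summable_on)
  have "(\<Sum>l\<in>F. (ip M u (e l))\<^sup>2) \<le> ip M u u" if F: "F \<subseteq> S" "finite F" for F
  proof -
    let ?p = "\<lambda>x. \<Sum>l\<in>F. ip M u (e l) * e l x"
    have *: "sq_integrable M (e l)" if "l \<in> F" for l
      using e F that by (auto simp: orthonormal_on_def)
    have "ip M u ?p = (\<Sum>l\<in>F. (ip M u (e l))\<^sup>2)"
      by (subst ip_commute, subst ip_sum_left[OF * u])
         (simp_all add: ip_commute[of M _ u] power2_eq_square)
    then have "ip M (\<lambda>x. u x - ?p x) (\<lambda>x. u x - ?p x) = ip M u u - (\<Sum>l\<in>F. (ip M u (e l))\<^sup>2)"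
      using ip_diff_self[OF u sq_integrable_sum[where F = F, OF *]] ip_orthonormal_sum_self[OF e F(2,1)] by simp
    then show ?thesis
      using ip_self_nonneg[of M "\<lambda>x. u x - ?p x"] by simp
  qed
  then show "bdd_above (sum (\<lambda>l. (ip M u (e l))\<^sup>2) ` {F. F \<subseteq> S \<and> finite F})"
    by (intro bdd_aboveI[of _ "ip M u u"]) auto
qed simp

text \<open>
  Pairing with \<open>w\<close> is continuous by Cauchy-Schwarz, so it may be applied termwise.
\<close>

lemma expands_has_sum_ip:
  assumes e: "orthonormal_on M S e" and u: "expands M S e c u" and w: "sq_integrable M w"
  shows "((\<lambda>l. c l * ip M (e l) w) has_sum ip M u w) S"
proof -
  let ?r = "\<lambda>F x. u x - (\<Sum>l\<in>F. c l * e l x)"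
  have lim: "((\<lambda>F. ip M (?r F) (?r F)) \<longlongrightarrow> 0) (finite_subsets_at_top S)" and u2: "sq_integrable M u"
    using u by (auto simp: expands_def Let_def)
  have "\<forall>\<^sub>F F in finite_subsets_at_top S.
      norm ((\<Sum>l\<in>F. c l * ip M (e l) w) - ip M u w) \<le> sqrt (ip M (?r F) (?r F) * ip M w w)"
  proof (rule eventually_finite_subsets_at_top_weakI)
    fix F assume F: "finite F" "F \<subseteq> S"
    have *: "sq_integrable M (e l)" if "l \<in> F" for l
      using e F that by (auto simp: orthonormal_on_def)
    have "ip M (?r F) w = ip M u w - (\<Sum>l\<in>F. c l * ip M (e l) w)"
      by (subst ip_diff_left[OF u2 sq_integrable_sum[OF *] w]) (simp_all add: ip_sum_left * w)
    then have "norm ((\<Sum>l\<in>F. c l * ip M (e l) w) - ip M u w) = sqrt ((ip M (?r F) w)\<^sup>2)"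
      by simp
    also have "\<dots> \<le> sqrt (ip M (?r F) (?r F) * ip M w w)"
      by (intro real_sqrt_le_mono ip_Cauchy_Schwarz sq_integrable_diff u2 sq_integrable_sum * w)
    finally show "norm ((\<Sum>l\<in>F. c l * ip M (e l) w) - ip M u w)
        \<le> sqrt (ip M (?r F) (?r F) * ip M w w)" .
  qed
  moreover have "((\<lambda>F. sqrt (ip M (?r F) (?r F) * ip M w w)) \<longlongrightarrow> 0) (finite_subsets_at_top S)"
    using tendsto_real_sqrt[OF tendsto_mult_left_zero[OF lim]] by simp
  ultimately have "((\<lambda>F. (\<Sum>l\<in>F. c l * ip M (e l) w) - ip M u w) \<longlongrightarrow> 0) (finite_subsets_at_top S)"
    by (rule Lim_null_comparison)
  then show ?thesis
    unfolding has_sum_def by (simp add: LIM_zero_iff)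
qed

lemma expands_coefficient:
  assumes e: "orthonormal_on M S e" and u: "expands M S e c u" and m: "m \<in> S"
  shows "ip M u (e m) = c m"
proof -
  have "((\<lambda>l. c l * ip M (e l) (e m)) has_sum ip M u (e m)) S"
    using e m by (intro expands_has_sum_ip[OF e u]) (auto simp: orthonormal_on_def)
  moreover have "((\<lambda>l. c l * ip M (e l) (e m)) has_sum c m) S"
    using e m by (intro has_sum_finite_neutralI[where B = "{m}"]) (auto simp: orthonormal_on_def)
  ultimately show ?thesis
    by (rule has_sum_unique)
qed

lemma Parseval_identity:
  assumes e: "orthonormal_on M S e" and u: "expands M S e c u" and w: "expands M S e d w"
  shows "((\<lambda>l. c l * d l) has_sum ip M u w) S"
proof -
  have "((\<lambda>l. c l * ip M (e l) w) has_sum ip M u w) S"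
    using w by (intro expands_has_sum_ip[OF e u]) (simp add: expands_def)
  then show ?thesis
    by (rule has_sum_cong[THEN iffD1, rotated])
       (simp add: ip_commute[of M _ w] expands_coefficient[OF e w])
qed

section \<open>Completeness of the space of square-integrable functions\<close>

text \<open>
  The measure is finite, so the \<open>L\<^sub>1\<close> norms of the increments decay geometrically as well; hence the sum
  of their absolute values is integrable and therefore finite almost everywhere.
\<close>
lemma AE_convergent_of_summable_sq_distances:
  fixes p :: "nat \<Rightarrow> 'a \<Rightarrow> real"
  assumes "finite_measure M" and p: "\<And>k. sq_integrable M (p k)"
    and d: "\<And>k. (\<integral>x. (p (Suc k) x - p k x)\<^sup>2 \<partial>M) \<le> (1 / 4) ^ k"
  shows "AE x in M. convergent (\<lambda>k. p k x)"
proof -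
  interpret finite_measure M by fact
  let ?d = "\<lambda>k x. \<bar>p (Suc k) x - p k x\<bar>"
  note [measurable] = sq_integrable_measurable[OF p]
  have sq: "integrable M (\<lambda>x. (p (Suc k) x - p k x)\<^sup>2)" for k
    using sq_integrable_diff[OF p p] by (simp add: sq_integrable_def)
  \<comment> \<open>An arithmetic-geometric mean estimate that bounds the \<open>L\<^sub>1\<close> norm by the \<open>L\<^sub>2\<close> norm; the weights
      are chosen so that both terms integrate to a multiple of \<open>(1 / 2) ^ k\<close>.\<close>
  have bd: "\<bar>a\<bar> \<le> (1 / 2) ^ k + 2 ^ k * a\<^sup>2" for a :: real and k
  proof -
    have "0 \<le> (1 - 2 ^ k * \<bar>a\<bar>)\<^sup>2" by simp
    then have "2 * (2 ^ k * \<bar>a\<bar>) \<le> 1 + (2 ^ k)\<^sup>2 * a\<^sup>2"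
      by (simp add: power2_diff power_mult_distrib)
    then have "2 * \<bar>a\<bar> \<le> (1 / 2) ^ k + 2 ^ k * a\<^sup>2"
      by (simp add: field_simps power2_eq_square)
    then show ?thesis by linarith
  qed
  have int: "integrable M (?d k)" for k
    by (rule Bochner_Integration.integrable_bound[where f = "\<lambda>x. (1 / 2) ^ k + 2 ^ k * (p (Suc k) x - p k x)\<^sup>2"])
       (use sq bd in auto)
  have le: "(\<integral>x. ?d k x \<partial>M) \<le> (measure M (space M) + 1) * (1 / 2) ^ k" for k
  proof -
    have "(\<integral>x. ?d k x \<partial>M) \<le> (\<integral>x. (1 / 2) ^ k + 2 ^ k * (p (Suc k) x - p k x)\<^sup>2 \<partial>M)"
      by (intro integral_mono int bd) (use sq in auto)
    also have "\<dots> = measure M (space M) * (1 / 2) ^ k + 2 ^ k * (\<integral>x. (p (Suc k) x - p k x)\<^sup>2 \<partial>M)"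
      using sq by simp
    also have "\<dots> \<le> measure M (space M) * (1 / 2) ^ k + 2 ^ k * (1 / 4) ^ k"
      by (intro add_left_mono mult_left_mono d) simp
    also have "\<dots> = (measure M (space M) + 1) * (1 / 2) ^ k"
      by (simp add: distrib_right flip: power_mult_distrib)
    finally show ?thesis .
  qed
  have "(\<integral>\<^sup>+x. (\<Sum>k. ennreal (?d k x)) \<partial>M) = (\<Sum>k. \<integral>\<^sup>+x. ennreal (?d k x) \<partial>M)"
    by (rule nn_integral_suminf) simp
  also have "\<dots> = (\<Sum>k. ennreal (\<integral>x. ?d k x \<partial>M))"
    by (intro suminf_cong nn_integral_eq_integral int) simp
  also have "\<dots> \<le> (\<Sum>k. ennreal ((measure M (space M) + 1) * (1 / 2) ^ k))"
    by (intro suminf_le ennreal_leI le) auto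
  also have "\<dots> < \<infinity>"
    by (subst suminf_ennreal2) (auto intro!: summable_mult summable_geometric)
  finally have "AE x in M. (\<Sum>k. ennreal (?d k x)) \<noteq> \<infinity>"
    by (intro nn_integral_PInf_AE) auto
  then show ?thesis
  proof eventually_elim
    fix x assume "(\<Sum>k. ennreal (?d k x)) \<noteq> \<infinity>"
    then have "summable (\<lambda>k. ?d k x)"
      by (intro summable_suminf_not_top) auto
    then have "summable (\<lambda>k. p (Suc k) x - p k x)"
      by (rule summable_rabs_cancel)
    then have "convergent (\<lambda>n. \<Sum>k<n. p (Suc k) x - p k x)"
      by (simp add: summable_iff_convergent)
    then have "convergent (\<lambda>n. p n x - p 0 x)"
      by (simp only: sum_lessThan_telescope[of "\<lambda>k. p k x"])
    then have "convergent (\<lambda>n. (p n x - p 0 x) + p 0 x)"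
      by (intro convergent_add convergent_const)
    then show "convergent (\<lambda>k. p k x)" by simp
  qed
qed

text \<open>
  The limit is taken pointwise, and Fatou's lemma carries the Cauchy estimates over to it.
\<close>

lemma Riesz_Fischer_sequence:
  fixes p :: "nat \<Rightarrow> 'a \<Rightarrow> real"
  assumes M: "finite_measure M" and p: "\<And>k. sq_integrable M (p k)"
    and d: "\<And>j k. j \<le> k \<Longrightarrow> (\<integral>x. (p k x - p j x)\<^sup>2 \<partial>M) \<le> (1 / 4) ^ j"
  obtains u where "sq_integrable M u" "\<And>j. (\<integral>x. (u x - p j x)\<^sup>2 \<partial>M) \<le> (1 / 4) ^ j"
proof
  define u where "u x = lim (\<lambda>k. p k x)" for x
  note [measurable] = sq_integrable_measurable[OF p]
  have u_meas [measurable]: "u \<in> borel_measurable M"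
    unfolding u_def by measurable
  have conv: "AE x in M. (\<lambda>k. p k x) \<longlonglongrightarrow> u x"
    using AE_convergent_of_summable_sq_distances[OF M p d[OF le_SucI[OF order_refl]]]
    by eventually_elim (simp add: u_def convergent_LIMSEQ_iff)
  have sq: "integrable M (\<lambda>x. (p k x - p j x)\<^sup>2)" for j k
    using sq_integrable_diff[OF p p] by (simp add: sq_integrable_def)
  have nn: "(\<integral>\<^sup>+x. ennreal ((u x - p j x)\<^sup>2) \<partial>M) \<le> ennreal ((1 / 4) ^ j)" for j
  proof -
    have "(\<integral>\<^sup>+x. ennreal ((u x - p j x)\<^sup>2) \<partial>M)
        = (\<integral>\<^sup>+x. liminf (\<lambda>k. ennreal ((p k x - p j x)\<^sup>2)) \<partial>M)"
      using conv
    proof (intro nn_integral_cong_AE, eventually_elim)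
      fix x assume "(\<lambda>k. p k x) \<longlonglongrightarrow> u x"
      then have "(\<lambda>k. ennreal ((p k x - p j x)\<^sup>2)) \<longlonglongrightarrow> ennreal ((u x - p j x)\<^sup>2)"
        by (intro tendsto_intros)
      then show "ennreal ((u x - p j x)\<^sup>2) = liminf (\<lambda>k. ennreal ((p k x - p j x)\<^sup>2))"
        by (intro lim_imp_Liminf[symmetric]) auto
    qed
    also have "\<dots> \<le> liminf (\<lambda>k. \<integral>\<^sup>+x. ennreal ((p k x - p j x)\<^sup>2) \<partial>M)"
      by (intro nn_integral_liminf) simp
    also have "\<dots> \<le> liminf (\<lambda>k. ennreal ((1 / 4) ^ j))"
    proof (rule Liminf_mono)
      show "\<forall>\<^sub>F k in sequentially. (\<integral>\<^sup>+x. ennreal ((p k x - p j x)\<^sup>2) \<partial>M) \<le> ennreal ((1 / 4) ^ j)"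
        using eventually_ge_at_top[of j]
        by eventually_elim (simp only: nn_integral_eq_integral[OF sq] zero_le_power2 AE_I2 ennreal_leI d)
    qed
    also have "\<dots> = ennreal ((1 / 4) ^ j)"
      by (simp add: Liminf_const)
    finally show ?thesis .
  qed
  have int: "integrable M (\<lambda>x. (u x - p j x)\<^sup>2)" for j
  proof (rule integrableI_nonneg)
    show "(\<integral>\<^sup>+x. ennreal ((u x - p j x)\<^sup>2) \<partial>M) < \<infinity>"
      using nn[of j] by (rule le_less_trans) simp
  qed auto
  show "(\<integral>x. (u x - p j x)\<^sup>2 \<partial>M) \<le> (1 / 4) ^ j" for j
    using nn[of j] by (simp add: nn_integral_eq_integral[OF int])
  have "sq_integrable M (\<lambda>x. u x - p 0 x)"
    using int[of 0] by (simp add: sq_integrable_def)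
  from sq_integrable_add[OF this p[of 0]] show "sq_integrable M u"
    by simp
qed

text \<open>
  Along finite sets \<open>H k\<close> that leave at most \<open>(1 / 4) ^ k\<close> of the total square sum, the partial sums
  converge quickly enough for the lemma on sequences. A partial sum over any larger finite set
  differs from the one over \<open>H k\<close> only by part of this remainder, so the limit of the sequence is the
  limit along all finite sets.
\<close>

lemma Riesz_Fischer:
  assumes M: "finite_measure M" and e: "orthonormal_on M S e"
    and c: "(\<lambda>l. (c l)\<^sup>2) summable_on S"
  shows "\<exists>u. expands M S e c u"
proof -
  define s where "s = (\<Sum>\<^sub>\<infinity>l\<in>S. (c l)\<^sup>2)"
  define P where "P F x = (\<Sum>l\<in>F. c l * e l x)" for F x
  have s: "((\<lambda>l. (c l)\<^sup>2) has_sum s) S"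
    unfolding s_def using c by simp
  have le_s: "(\<Sum>l\<in>F. (c l)\<^sup>2) \<le> s" if "finite F" "F \<subseteq> S" for F
    unfolding s_def using that by (intro finite_sum_le_infsum c) auto
  have "\<exists>F. finite F \<and> F \<subseteq> S \<and> s - (1 / 4) ^ k < (\<Sum>l\<in>F. (c l)\<^sup>2)" for k :: nat
  proof -
    have "\<forall>\<^sub>F F in finite_subsets_at_top S. s - (1 / 4) ^ k < (\<Sum>l\<in>F. (c l)\<^sup>2)"
      using s unfolding has_sum_def by (rule order_tendstoD) simp
    then show ?thesis
      by (auto simp: eventually_finite_subsets_at_top)
  qed
  then obtain G where G: "finite (G k)" "G k \<subseteq> S" "s - (1 / 4) ^ k < (\<Sum>l\<in>G k. (c l)\<^sup>2)" for k :: nat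
    by metis
  define H where "H k = (\<Union>j\<le>k. G j)" for k
  have H: "finite (H k)" "H k \<subseteq> S" for k
    using G by (auto simp: H_def)
  have H_mono: "H j \<subseteq> H k" if "j \<le> k" for j k
    unfolding H_def using that by (intro UN_mono) auto
  have P2: "sq_integrable M (P F)" if "F \<subseteq> S" for F
    unfolding P_def using e that by (intro sq_integrable_sum) (auto simp: orthonormal_on_def)
  have diff: "(\<lambda>x. P F x - P (H k) x) = P (F - H k)" if "finite F" "H k \<subseteq> F" for F k
    using that by (intro ext) (simp add: P_def sum_diff)
  have tail: "ip M (P (F - H k)) (P (F - H k)) \<le> (1 / 4) ^ k" if F: "finite F" "F \<subseteq> S" "H k \<subseteq> F" for F k
  proof -
    have "ip M (P (F - H k)) (P (F - H k)) = (\<Sum>l\<in>F - H k. (c l)\<^sup>2)"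
      unfolding P_def using F by (intro ip_orthonormal_sum_self[OF e]) auto
    also have "\<dots> \<le> (\<Sum>l\<in>F - G k. (c l)\<^sup>2)"
      using F by (intro sum_mono2) (auto simp: H_def)
    also have "\<dots> = (\<Sum>l\<in>F. (c l)\<^sup>2) - (\<Sum>l\<in>G k. (c l)\<^sup>2)"
      using F G by (intro sum_diff) (auto simp: H_def)
    also have "\<dots> \<le> (1 / 4) ^ k"
      using le_s[OF F(1,2)] G(3)[of k] by linarith
    finally show ?thesis .
  qed
  have cauchy: "(\<integral>x. (P (H k) x - P (H j) x)\<^sup>2 \<partial>M) \<le> (1 / 4) ^ j" if "j \<le> k" for j k
    using tail[OF H H_mono[OF that]] diff[OF H(1) H_mono[OF that], THEN fun_cong]
    by (simp add: ip_def power2_eq_square)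
  from Riesz_Fischer_sequence[OF M P2[OF H(2)] cauchy]
  obtain u where u: "sq_integrable M u" "\<And>j. (\<integral>x. (u x - P (H j) x)\<^sup>2 \<partial>M) \<le> (1 / 4) ^ j"
    by blast
  have near: "ip M (\<lambda>x. u x - P F x) (\<lambda>x. u x - P F x) \<le> 4 * (1 / 4) ^ k"
    if F: "finite F" "F \<subseteq> S" "H k \<subseteq> F" for F k
  proof -
    have "(\<lambda>x. u x - P F x) = (\<lambda>x. (u x - P (H k) x) - P (F - H k) x)"
      using diff[OF F(1,3), THEN fun_cong] by (auto simp: algebra_simps)
    then have "ip M (\<lambda>x. u x - P F x) (\<lambda>x. u x - P F x)
        \<le> 2 * ip M (\<lambda>x. u x - P (H k) x) (\<lambda>x. u x - P (H k) x) + 2 * ip M (P (F - H k)) (P (F - H k))"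
      using ip_diff_self_le[OF sq_integrable_diff[OF u(1) P2[OF H(2)]] P2[of "F - H k"]] F(2) by auto
    then show ?thesis
      using u(2)[of k] tail[OF F] by (simp add: ip_def power2_eq_square)
  qed
  have "((\<lambda>F. ip M (\<lambda>x. u x - P F x) (\<lambda>x. u x - P F x)) \<longlongrightarrow> 0) (finite_subsets_at_top S)"
  proof (rule tendstoI)
    fix \<epsilon> :: real assume "0 < \<epsilon>"
    then obtain k where k: "(1 / 4) ^ k < \<epsilon> / 4"
      using real_arch_pow_inv[of "\<epsilon> / 4" "1 / 4"] by auto
    have "\<forall>\<^sub>F F in finite_subsets_at_top S. finite F \<and> H k \<subseteq> F \<and> F \<subseteq> S"
      unfolding eventually_finite_subsets_at_top using H by blast
    then show "\<forall>\<^sub>F F in finite_subsets_at_top S.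
        dist (ip M (\<lambda>x. u x - P F x) (\<lambda>x. u x - P F x)) 0 < \<epsilon>"
    proof eventually_elim
      fix F assume "finite F \<and> H k \<subseteq> F \<and> F \<subseteq> S"
      then show "dist (ip M (\<lambda>x. u x - P F x) (\<lambda>x. u x - P F x)) 0 < \<epsilon>"
        using near[of F k] k ip_self_nonneg[of M "\<lambda>x. u x - P F x"] by simp
    qed
  qed
  then show ?thesis
    using u(1) by (auto simp: expands_def P_def Let_def)
qed


section \<open>The weighted space on the interval\<close>

definition weighted_measure :: "(real \<Rightarrow> real) \<Rightarrow> real \<Rightarrow> real measure" where
  "weighted_measure v xmax = density (restrict_space lborel {0..xmax}) (\<lambda>x. ennreal (1 / (v x)\<^sup>2))"

lemma borel_measurable_weighted_measure:
  fixes u :: "real \<Rightarrow> real"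
  shows "u \<in> borel_measurable (weighted_measure v xmax) \<longleftrightarrow> set_borel_measurable lborel {0..xmax} u"
  unfolding weighted_measure_def set_borel_measurable_def
  by (simp add: borel_measurable_restrict_space_iff)

locale wave_speed =
  fixes v :: "real \<Rightarrow> real" and xmax :: real
  assumes xmax_pos: "0 < xmax"
    and v_cont: "continuous_on {0..xmax} v"
    and v_pos: "\<And>x. x \<in> {0..xmax} \<Longrightarrow> 0 < v x"
begin

abbreviation M :: "real measure" where
  "M \<equiv> weighted_measure v xmax"

lemma weight_continuous: "continuous_on {0..xmax} (\<lambda>x. 1 / (v x)\<^sup>2)"
  using v_pos by (intro continuous_intros v_cont) fastforce

lemma continuous_measurable:
  fixes f :: "real \<Rightarrow> real"
  shows "continuous_on {0..xmax} f \<Longrightarrow> f \<in> borel_measurable (restrict_space lborel {0..xmax})"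
  using borel_measurable_continuous_on_restrict[of "{0..xmax}" f]
  by (simp add: measurable_cong_sets[OF sets_restrict_space_cong[OF sets_lborel] refl])

lemma
  assumes "u \<in> borel_measurable M"
  shows integrable_M: "integrable M u \<longleftrightarrow> set_integrable lborel {0..xmax} (\<lambda>x. u x * (1 / (v x)\<^sup>2))"
    and integral_M: "integral\<^sup>L M u = (LINT x:{0..xmax}|lborel. u x * (1 / (v x)\<^sup>2))"
proof -
  have u: "u \<in> borel_measurable (restrict_space lborel {0..xmax})"
    using assms by (simp add: weighted_measure_def)
  note w = continuous_measurable[OF weight_continuous]
  show "integrable M u \<longleftrightarrow> set_integrable lborel {0..xmax} (\<lambda>x. u x * (1 / (v x)\<^sup>2))"
    unfolding weighted_measure_def set_integrable_def
    by (subst integrable_density[OF u w]) (simp_all add: integrable_restrict_space mult.commute)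
  show "integral\<^sup>L M u = (LINT x:{0..xmax}|lborel. u x * (1 / (v x)\<^sup>2))"
    unfolding weighted_measure_def set_lebesgue_integral_def
    by (subst integral_density[OF u w]) (simp_all add: integral_restrict_space mult.commute)
qed

lemma continuous_integrable_M:
  fixes f :: "real \<Rightarrow> real"
  assumes f: "continuous_on {0..xmax} f"
  shows "integrable M f"
proof -
  have "f \<in> borel_measurable M"
    using continuous_measurable[OF f] by (simp add: weighted_measure_def)
  then show ?thesis
    by (simp only: integrable_M)
       (intro borel_integrable_atLeastAtMost' continuous_on_mult f weight_continuous)
qed

lemma finite_measure_M: "finite_measure M"
proof (rule finite_measureI)
  have "integrable M (\<lambda>x. 1 :: real)"
    by (rule continuous_integrable_M) simp
  then show "emeasure M (space M) \<noteq> \<infinity>"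
    by (simp add: integrable_iff_bounded)
qed

lemma continuous_sq_integrable:
  assumes f: "continuous_on {0..xmax} f"
  shows "sq_integrable M f"
  unfolding sq_integrable_def
  by (intro conjI borel_measurable_integrable continuous_integrable_M continuous_on_power f)

lemma wip_eq_ip:
  assumes "u \<in> borel_measurable M" "w \<in> borel_measurable M"
  shows "wip v xmax u w = ip M u w"
  using assms by (simp add: wip_def ip_def integral_M)

lemma L2w_iff: "u \<in> L2w v xmax \<longleftrightarrow> sq_integrable M u"
proof (cases "u \<in> borel_measurable M")
  case True
  then show ?thesis
    using borel_measurable_weighted_measure[of u v xmax]
    by (simp add: L2w_def sq_integrable_def integrable_M)
next
  case False
  then show ?thesis
    by (simp add: L2w_def sq_integrable_def borel_measurable_weighted_measure)
qed

section \<open>Eigenfunctions\<close>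

definition eigenpair :: "real \<Rightarrow> (real \<Rightarrow> real) \<Rightarrow> (real \<Rightarrow> real) \<Rightarrow> bool" where
  "eigenpair l \<phi> \<phi>' \<longleftrightarrow>
     (\<forall>x\<in>{0..xmax}. (\<phi> has_real_derivative \<phi>' x) (at x within {0..xmax})) \<and>
     (\<forall>x\<in>{0..xmax}. (\<phi>' has_real_derivative - (l * \<phi> x / (v x)\<^sup>2)) (at x within {0..xmax})) \<and>
     \<phi>' 0 = 0 \<and> \<phi> xmax = 0"

lemma eigenpair_continuous:
  assumes "eigenpair l \<phi> \<phi>'"
  shows "continuous_on {0..xmax} \<phi>" "continuous_on {0..xmax} \<phi>'"
  using assms by (auto simp: eigenpair_def intro: DERIV_continuous_on)

text \<open>
  The weak second derivative agrees almost everywhere with the continuous function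
  \<open>- l \<phi> / v\<^sup>2\<close>, so \<open>\<phi>'\<close> is an integral of a continuous function and hence differentiable everywhere.
\<close>

lemma eigenfunction_classical:
  assumes "normalized_eigenfunction v xmax l \<phi>"
  shows "\<exists>\<phi>'. eigenpair l \<phi> \<phi>'"
proof -
  let ?g = "\<lambda>x. - (l * \<phi> x / (v x)\<^sup>2)"
  from assms obtain d dd where
    d: "\<And>x. x \<in> {0..xmax} \<Longrightarrow> (\<phi> has_real_derivative d x) (at x within {0..xmax})"
    and dd: "dd \<in> L2w v xmax"
    and int: "\<And>x. x \<in> {0..xmax} \<Longrightarrow> d x = d 0 + (LINT t:{0..x}|lborel. dd t)"
    and bc: "d 0 = 0" "\<phi> xmax = 0"
    and ae: "AE x in lborel. x \<in> {0..xmax} \<longrightarrow> l * \<phi> x = - (v x)\<^sup>2 * dd x"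
    unfolding normalized_eigenfunction_def A_graph_def by blast
  have \<phi>: "continuous_on {0..xmax} \<phi>"
    using d by (rule DERIV_continuous_on)
  have g: "continuous_on {0..xmax} ?g"
    using v_pos by (intro continuous_intros v_cont \<phi>) fastforce
  have eq: "d x = integral {0..x} ?g" if x: "x \<in> {0..xmax}" for x
  proof -
    have gx: "set_integrable lborel {0..x} ?g"
      using x by (intro borel_integrable_atLeastAtMost' continuous_on_subset[OF g]) auto
    have "(LINT t:{0..x}|lborel. dd t) = (LINT t:{0..x}|lborel. ?g t)"
      unfolding set_lebesgue_integral_def
    proof (rule integral_cong_AE)
      have "set_borel_measurable lborel {0..x} dd"
        by (rule set_borel_measurable_subset[of _ "{0..xmax}"]) (use dd x in \<open>auto simp: L2w_def\<close>)
      then show "(\<lambda>t. indicator {0..x} t *\<^sub>R dd t) \<in> borel_measurable lborel"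
        by (simp add: set_borel_measurable_def)
      show "(\<lambda>t. indicator {0..x} t *\<^sub>R ?g t) \<in> borel_measurable lborel"
        using gx unfolding set_integrable_def by (rule borel_measurable_integrable)
      show "AE t in lborel. indicator {0..x} t *\<^sub>R dd t = indicator {0..x} t *\<^sub>R ?g t"
        using ae
      proof eventually_elim
        fix t assume "t \<in> {0..xmax} \<longrightarrow> l * \<phi> t = - (v t)\<^sup>2 * dd t"
        then show "indicator {0..x} t *\<^sub>R dd t = indicator {0..x} t *\<^sub>R ?g t"
          using x v_pos[of t] by (auto simp: indicator_def)
      qed
    qed
    also have "\<dots> = integral {0..x} ?g"
      by (rule set_borel_integral_eq_integral(2)[OF gx])
    finally show ?thesis
      using int[OF x] bc by simp
  qed
  have "(d has_real_derivative ?g x) (at x within {0..xmax})" if "x \<in> {0..xmax}" for x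
    unfolding has_field_derivative_def
    by (rule has_derivative_transform[OF that eq
        integral_has_real_derivative[OF g that, unfolded has_field_derivative_def]])
  with d bc have "eigenpair l \<phi> d"
    by (simp add: eigenpair_def)
  then show ?thesis by blast
qed

text \<open>
  Green's identity: \<open>\<phi>' \<psi>\<close> has the derivative \<open>\<phi>' \<psi>' - l \<phi> \<psi> / v\<^sup>2\<close> and vanishes at both end points, by
  the boundary condition of \<open>\<phi>'\<close> at \<open>0\<close> and that of \<open>\<psi>\<close> at \<open>xmax\<close>. With the two functions
  exchanged it yields orthogonality, and with \<open>\<phi> = \<psi>\<close> nonnegativity of the eigenvalues.
\<close>

lemma energy_product:
  assumes "eigenpair l \<phi> \<phi>'" "eigenpair m \<psi> \<psi>'"
  shows "(LINT x:{0..xmax}|lborel. \<phi>' x * \<psi>' x) = l * wip v xmax \<phi> \<psi>"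
proof -
  note c = eigenpair_continuous[OF assms(1)] eigenpair_continuous[OF assms(2)]
  let ?w = "\<lambda>x. \<phi> x * \<psi> x * (1 / (v x)\<^sup>2)"
  have int: "set_integrable lborel {0..xmax} (\<lambda>x. \<phi>' x * \<psi>' x)"
    "set_integrable lborel {0..xmax} (\<lambda>x. l * ?w x)"
    by (intro borel_integrable_atLeastAtMost' continuous_on_mult continuous_on_const c weight_continuous)+
  have cont: "continuous_on {0..xmax} (\<lambda>x. \<phi>' x * \<psi>' x - l * ?w x)"
    by (intro continuous_on_diff continuous_on_mult continuous_on_const c weight_continuous)
  have "(LINT x:{0..xmax}|lborel. \<phi>' x * \<psi>' x - l * ?w x) = \<phi>' xmax * \<psi> xmax - \<phi>' 0 * \<psi> 0"
    unfolding set_lebesgue_integral_def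
  proof (rule integral_FTC_Icc)
    fix x assume "0 \<le> x" "x \<le> xmax"
    then have x: "x \<in> {0..xmax}" by simp
    have "((\<lambda>x. \<phi>' x * \<psi> x) has_real_derivative \<phi>' x * \<psi>' x - l * ?w x) (at x within {0..xmax})"
      using assms x unfolding eigenpair_def
      by (auto intro!: derivative_eq_intros simp: algebra_simps)
    then show "((\<lambda>x. \<phi>' x * \<psi> x) has_vector_derivative \<phi>' x * \<psi>' x - l * ?w x) (at x within {0..xmax})"
      by (simp add: has_real_derivative_iff_has_vector_derivative)
  qed (use xmax_pos cont in simp_all)
  moreover have "\<phi>' 0 = 0" "\<psi> xmax = 0"
    using assms by (auto simp: eigenpair_def)
  ultimately have "(LINT x:{0..xmax}|lborel. \<phi>' x * \<psi>' x) = (LINT x:{0..xmax}|lborel. l * ?w x)"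
    using set_integral_diff(2)[OF int] by simp
  then show ?thesis
    unfolding wip_def by (simp only: set_integral_mult_right)
qed

lemma eigenfunction_integral_deriv:
  assumes "eigenpair l \<phi> \<phi>'"
  shows "(LINT x:{0..xmax}|lborel. \<phi>' x) = - \<phi> 0"
proof -
  have "(LINT x:{0..xmax}|lborel. \<phi>' x) = \<phi> xmax - \<phi> 0"
    unfolding set_lebesgue_integral_def
    by (rule integral_FTC_Icc)
       (use assms xmax_pos eigenpair_continuous[OF assms] in
         \<open>auto simp: eigenpair_def has_real_derivative_iff_has_vector_derivative\<close>)
  then show ?thesis
    using assms by (simp add: eigenpair_def)
qed

lemma eigenvalue_pos:
  assumes "normalized_eigenfunction v xmax l \<phi>"
  shows "0 < l"
proof -
  obtain \<phi>' where \<phi>: "eigenpair l \<phi> \<phi>'"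
    using eigenfunction_classical[OF assms] by blast
  have one: "wip v xmax \<phi> \<phi> = 1"
    using assms by (simp add: normalized_eigenfunction_def)
  have "0 \<le> (LINT x:{0..xmax}|lborel. \<phi>' x * \<phi>' x)"
    unfolding set_lebesgue_integral_def by simp
  then have "0 \<le> l"
    using energy_product[OF \<phi> \<phi>] one by simp
  moreover have "l \<noteq> 0"
  proof
    assume "l = 0"
    then have "\<exists>c. \<forall>x\<in>{0..xmax}. \<phi>' x = c"
      using \<phi> by (intro has_field_derivative_zero_constant) (auto simp: eigenpair_def)
    then have "\<phi>' x = 0" if "x \<in> {0..xmax}" for x
      using that \<phi> xmax_pos by (force simp: eigenpair_def)
    then have "\<exists>c. \<forall>x\<in>{0..xmax}. \<phi> x = c"
      using \<phi> by (intro has_field_derivative_zero_constant) (auto simp: eigenpair_def)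
    then have "\<phi> x = 0" if "x \<in> {0..xmax}" for x
      using that \<phi> xmax_pos by (force simp: eigenpair_def)
    then have "wip v xmax \<phi> \<phi> = (LINT x:{0..xmax}|lborel. 0)"
      unfolding wip_def by (intro set_lebesgue_integral_cong) auto
    then show False
      using one by (simp add: set_lebesgue_integral_def)
  qed
  ultimately show ?thesis by simp
qed

abbreviation spec :: "real set" where
  "spec \<equiv> A_spectrum v xmax"

abbreviation ef :: "real \<Rightarrow> real \<Rightarrow> real" where
  "ef \<equiv> A_eigenfunction v xmax"

definition ef' :: "real \<Rightarrow> real \<Rightarrow> real" where
  "ef' l = (SOME \<phi>'. eigenpair l (ef l) \<phi>')"

lemma normalized_ef: "l \<in> spec \<Longrightarrow> normalized_eigenfunction v xmax l (ef l)"
  unfolding A_spectrum_def A_eigenfunction_def mem_Collect_eq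
  by (rule someI_ex[of "normalized_eigenfunction v xmax l"])

lemma eigenpair_ef:
  assumes "l \<in> spec"
  shows "eigenpair l (ef l) (ef' l)"
  unfolding ef'_def by (rule someI_ex[OF eigenfunction_classical[OF normalized_ef[OF assms]]])

lemma spec_pos: "l \<in> spec \<Longrightarrow> 0 < l"
  using eigenvalue_pos normalized_ef by blast

lemma wip_ef:
  assumes "l \<in> spec" "m \<in> spec"
  shows "wip v xmax (ef l) (ef m) = of_bool (l = m)"
proof (cases "l = m")
  case True
  then show ?thesis
    using normalized_ef[OF assms(1)] by (simp add: normalized_eigenfunction_def)
next
  case False
  have comm: "wip v xmax (ef m) (ef l) = wip v xmax (ef l) (ef m)"
    by (simp add: wip_def mult.commute)
  have "l * wip v xmax (ef l) (ef m) = (LINT x:{0..xmax}|lborel. ef' l x * ef' m x)"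
    using energy_product[OF eigenpair_ef[OF assms(1)] eigenpair_ef[OF assms(2)]] by simp
  also have "\<dots> = (LINT x:{0..xmax}|lborel. ef' m x * ef' l x)"
    by (simp add: mult.commute)
  also have "\<dots> = m * wip v xmax (ef l) (ef m)"
    using energy_product[OF eigenpair_ef[OF assms(2)] eigenpair_ef[OF assms(1)]] comm by simp
  finally show ?thesis
    using False by simp
qed

lemma ef_sq_integrable: "l \<in> spec \<Longrightarrow> sq_integrable M (ef l)"
  by (rule continuous_sq_integrable[OF eigenpair_continuous(1)[OF eigenpair_ef]])

lemma ef_orthonormal: "orthonormal_on M spec ef"
  unfolding orthonormal_on_def
  using ef_sq_integrable wip_ef by (auto simp flip: wip_eq_ip simp: sq_integrable_measurable)

text \<open>
  By Green's identity the functions \<open>ef' l / sqrt l\<close> are orthonormal in the unweighted space. The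
  pairing of the constant 1 with them is \<open>- ef l 0 / sqrt l\<close>, and Bessel's inequality applies.
\<close>

lemma summable_ef_at_0: "(\<lambda>l. (ef l 0)\<^sup>2 / l) summable_on spec"
proof -
  \<comment> \<open>The unweighted space is the weighted one for the constant speed 1.\<close>
  interpret unit: wave_speed "\<lambda>_. 1" xmax
    by unfold_locales (use xmax_pos in auto)
  let ?e = "\<lambda>l x. ef' l x / sqrt l"
  have sq: "sq_integrable unit.M (?e l)" if "l \<in> spec" for l
    using spec_pos[OF that]
    by (intro unit.continuous_sq_integrable continuous_on_divide continuous_on_const
        eigenpair_continuous[OF eigenpair_ef[OF that]]) auto
  have ip: "ip unit.M (?e l) (?e m) = of_bool (l = m)" if lm: "l \<in> spec" "m \<in> spec" for l m
  proof -
    have "ip unit.M (?e l) (?e m) = (LINT x:{0..xmax}|lborel. ef' l x * ef' m x) / (sqrt l * sqrt m)"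
      using sq lm
      by (simp add: wip_def sq_integrable_measurable flip: unit.wip_eq_ip set_integral_divide_zero)
    also have "\<dots> = l * of_bool (l = m) / (sqrt l * sqrt m)"
      using energy_product[OF eigenpair_ef eigenpair_ef, OF lm] wip_ef[OF lm] by simp
    also have "\<dots> = of_bool (l = m)"
      using spec_pos[OF lm(1)] by auto
    finally show ?thesis .
  qed
  have orth: "orthonormal_on unit.M spec ?e"
    using sq ip by (simp add: orthonormal_on_def)
  have one: "sq_integrable unit.M (\<lambda>_. 1)"
    by (intro unit.continuous_sq_integrable continuous_on_const)
  have "(ip unit.M (\<lambda>_. 1) (?e l))\<^sup>2 = (ef l 0)\<^sup>2 / l" if l: "l \<in> spec" for l
  proof -
    have "ip unit.M (\<lambda>_. 1) (?e l) = (LINT x:{0..xmax}|lborel. ef' l x) / sqrt l"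
      using sq[OF l] one
      by (simp add: wip_def sq_integrable_measurable flip: unit.wip_eq_ip set_integral_divide_zero)
    then show ?thesis
      using eigenfunction_integral_deriv[OF eigenpair_ef[OF l]] spec_pos[OF l]
      by (simp add: power_divide)
  qed
  then show ?thesis
    using Bessel_inequality[OF orth one] by (simp cong: summable_on_cong)
qed

text \<open>
  The choice in the definition of \<open>fun_of_A\<close> is justified: by the Riesz-Fischer theorem there is a
  function to choose.
\<close>

lemma fun_of_A_expands:
  assumes "(\<lambda>l. (g l * z (ef l))\<^sup>2) summable_on spec"
  shows "expands M spec ef (\<lambda>l. g l * z (ef l)) (fun_of_A v xmax g z)"
proof -
  have "(u \<in> L2w v xmax \<and>
      ((\<lambda>F. let r = (\<lambda>x. u x - (\<Sum>l\<in>F. g l * z (ef l) * ef l x)) in wip v xmax r r) \<longlongrightarrow> 0)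
        (finite_subsets_at_top spec))
    \<longleftrightarrow> expands M spec ef (\<lambda>l. g l * z (ef l)) u" for u
  proof (cases "sq_integrable M u")
    case True
    let ?r = "\<lambda>F x. u x - (\<Sum>l\<in>F. g l * z (ef l) * ef l x)"
    have "\<forall>\<^sub>F F in finite_subsets_at_top spec. wip v xmax (?r F) (?r F) = ip M (?r F) (?r F)"
    proof (rule eventually_finite_subsets_at_top_weakI)
      fix F assume "F \<subseteq> spec"
      then have "sq_integrable M (?r F)"
        by (intro sq_integrable_diff True sq_integrable_sum ef_sq_integrable) auto
      then show "wip v xmax (?r F) (?r F) = ip M (?r F) (?r F)"
        by (intro wip_eq_ip sq_integrable_measurable)
    qed
    from tendsto_cong[OF this] show ?thesis
      using True by (simp add: expands_def L2w_iff Let_def)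
  qed (simp add: expands_def L2w_iff)
  then show ?thesis
    unfolding fun_of_A_def
    using someI_ex[OF Riesz_Fischer[OF finite_measure_M ef_orthonormal assms]] by simp
qed

text \<open>
  The bound on \<open>g\<close> covers the cosines of \<open>sqrt A\<close> that produce the snapshots and the propagator.
\<close>

lemma op_of_A_expands:
  assumes g: "\<And>l. l \<in> spec \<Longrightarrow> \<bar>g l\<bar> \<le> 1" and u: "sq_integrable M u"
  shows "expands M spec ef (\<lambda>l. g l * wip v xmax u (ef l)) (op_of_A v xmax g u)"
  unfolding op_of_A_def
proof (rule fun_of_A_expands)
  have "(\<lambda>l. (ip M u (ef l))\<^sup>2) summable_on spec"
    by (rule Bessel_inequality[OF ef_orthonormal u])
  then show "(\<lambda>l. (g l * wip v xmax u (ef l))\<^sup>2) summable_on spec"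
  proof (rule summable_on_comparison_test)
    fix l assume l: "l \<in> spec"
    have "wip v xmax u (ef l) = ip M u (ef l)"
      by (intro wip_eq_ip sq_integrable_measurable u ef_sq_integrable l)
    moreover have "(g l)\<^sup>2 \<le> 1"
      using g[OF l] by (simp add: abs_square_le_1)
    ultimately show "(g l * wip v xmax u (ef l))\<^sup>2 \<le> (ip M u (ef l))\<^sup>2"
      by (simp add: power_mult_distrib mult_left_le_one_le)
  qed simp
qed

end

section \<open>The source lies in the weighted space\<close>

text \<open>
  Two integrations by parts. The truncation point is a zero of \<open>sin (t s)\<close>, so the boundary term with
  \<open>q\<close> disappears whatever the size of \<open>q\<close> there; the one with \<open>q'\<close> is bounded because \<open>q''\<close> is integrable.
\<close>

lemma truncated_cosine_transform_bound:
  fixes q q' q'' :: "real \<Rightarrow> real"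
  assumes q: "\<And>t. (q has_real_derivative q' t) (at t)"
    and q': "\<And>t. (q' has_real_derivative q'' t) (at t)"
    and q'': "continuous_on UNIV q''" "integrable lborel q''"
    and s: "0 < s" and T: "0 \<le> T" "sin (T * s) = 0"
  shows "\<bar>LINT t:{0..T}|lborel. 2 * cos (t * s) * q t\<bar>
     \<le> (4 * \<bar>q' 0\<bar> + 4 * (LINT t|lborel. \<bar>q'' t\<bar>)) / s\<^sup>2"
proof -
  let ?K = "LINT t|lborel. \<bar>q'' t\<bar>"
  have qc: "continuous_on A q" "continuous_on A q'" "continuous_on A q''" for A
    using q q' q''(1) by (auto intro: DERIV_continuous_on has_field_derivative_at_within
        continuous_on_subset)
  have q'_bound: "\<bar>q' T\<bar> \<le> \<bar>q' 0\<bar> + ?K"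
  proof -
    have "(LINT t:{0..T}|lborel. q'' t) = q' T - q' 0"
      unfolding set_lebesgue_integral_def
      by (rule integral_FTC_Icc)
         (use T qc q' in \<open>auto simp: has_real_derivative_iff_has_vector_derivative
           intro: has_vector_derivative_at_within\<close>)
    moreover have "\<bar>LINT t:{0..T}|lborel. q'' t\<bar> \<le> ?K"
      unfolding set_lebesgue_integral_def
    proof (rule order_trans[OF integral_abs_bound], rule integral_mono)
      show "integrable lborel (\<lambda>t. \<bar>indicator {0..T} t *\<^sub>R q'' t\<bar>)"
        using q''(2) by (intro integrable_abs integrable_mult_indicator) auto
    qed (use q''(2) in \<open>auto simp: indicator_def\<close>)
    ultimately show ?thesis by linarith
  qed
  \<comment> \<open>In the derivative of \<open>?F\<close> the two terms with \<open>q'\<close> cancel, which does both integrations by parts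
      at once.\<close>
  let ?F = "\<lambda>t. 2 * sin (t * s) / s * q t + 2 * cos (t * s) / s\<^sup>2 * q' t"
  let ?h = "\<lambda>t. 2 * cos (t * s) * q t" and ?k = "\<lambda>t. 2 * cos (t * s) / s\<^sup>2 * q'' t"
  have int: "set_integrable lborel {0..T} ?h" "set_integrable lborel {0..T} ?k"
    using s by (auto intro!: borel_integrable_atLeastAtMost' continuous_intros qc)
  have "(LINT t:{0..T}|lborel. ?h t + ?k t) = ?F T - ?F 0"
    unfolding set_lebesgue_integral_def
  proof (rule integral_FTC_Icc)
    fix t
    have "(?F has_real_derivative ?h t + ?k t) (at t)"
      by (rule derivative_eq_intros refl q q' | use s in \<open>simp add: field_simps power2_eq_square\<close>)+
    then show "(?F has_vector_derivative ?h t + ?k t) (at t within {0..T})"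
      by (simp add: has_real_derivative_iff_has_vector_derivative has_vector_derivative_at_within)
  qed (use T s in \<open>auto intro!: continuous_intros qc\<close>)
  then have eq: "(LINT t:{0..T}|lborel. ?h t)
      = (2 * cos (T * s) * q' T - 2 * q' 0) / s\<^sup>2 - (LINT t:{0..T}|lborel. ?k t)"
    using set_integral_add(2)[OF int] T by (simp add: diff_divide_distrib)
  have "\<bar>2 * cos (T * s) * q' T\<bar> \<le> 2 * \<bar>q' T\<bar>"
    using abs_cos_le_one[of "T * s"] by (simp add: abs_mult mult_left_le_one_le)
  then have 1: "\<bar>2 * cos (T * s) * q' T - 2 * q' 0\<bar> \<le> 4 * \<bar>q' 0\<bar> + 2 * ?K"
    using q'_bound by linarith
  have 2: "\<bar>LINT t:{0..T}|lborel. ?k t\<bar> \<le> 2 * ?K / s\<^sup>2"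
  proof -
    have "\<bar>LINT t:{0..T}|lborel. ?k t\<bar> \<le> (LINT t|lborel. \<bar>indicator {0..T} t *\<^sub>R ?k t\<bar>)"
      unfolding set_lebesgue_integral_def by (rule integral_abs_bound)
    also have "\<dots> \<le> (LINT t|lborel. 2 / s\<^sup>2 * \<bar>q'' t\<bar>)"
    proof (rule integral_mono)
      show "integrable lborel (\<lambda>t. \<bar>indicator {0..T} t *\<^sub>R ?k t\<bar>)"
        using int(2) unfolding set_integrable_def by (rule integrable_abs)
      show "integrable lborel (\<lambda>t. 2 / s\<^sup>2 * \<bar>q'' t\<bar>)"
        using q''(2) by (intro integrable_mult_right integrable_abs)
      fix t
      have "\<bar>cos (t * s)\<bar> * \<bar>q'' t\<bar> \<le> \<bar>q'' t\<bar>"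
        by (intro mult_left_le_one_le) auto
      then show "\<bar>indicator {0..T} t *\<^sub>R ?k t\<bar> \<le> 2 / s\<^sup>2 * \<bar>q'' t\<bar>"
        using s by (auto simp: indicator_def abs_mult divide_right_mono)
    qed
    finally show ?thesis by simp
  qed
  have "\<bar>LINT t:{0..T}|lborel. ?h t\<bar>
      \<le> \<bar>2 * cos (T * s) * q' T - 2 * q' 0\<bar> / s\<^sup>2 + \<bar>LINT t:{0..T}|lborel. ?k t\<bar>"
    unfolding eq by (rule order_trans[OF abs_triangle_ineq4]) (simp add: abs_divide)
  also have "\<dots> \<le> (4 * \<bar>q' 0\<bar> + 2 * ?K) / s\<^sup>2 + 2 * ?K / s\<^sup>2"
    using 1 2 by (intro add_mono divide_right_mono) auto
  finally show ?thesis by (simp add: add_divide_distrib)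
qed

text \<open>
  The truncated transforms converge along the points \<open>k \<pi> / s\<close>, at which they are bounded uniformly.
\<close>

lemma qtilde_decay:
  fixes q q' q'' :: "real \<Rightarrow> real"
  assumes q0: "integrable lborel q"
    and q: "\<And>t. (q has_real_derivative q' t) (at t)"
    and q': "\<And>t. (q' has_real_derivative q'' t) (at t)"
    and q'': "continuous_on UNIV q''" "integrable lborel q''"
    and l: "0 < l"
  shows "\<bar>qtilde q l\<bar> \<le> (4 * \<bar>q' 0\<bar> + 4 * (LINT t|lborel. \<bar>q'' t\<bar>)) / l" (is "_ \<le> ?C")
proof -
  define s where "s = sqrt l"
  have s: "0 < s" "s\<^sup>2 = l"
    using l by (auto simp: s_def)
  let ?h = "\<lambda>t. 2 * cos (t * s) * q t"
  define T where "T k = pi / s * real k" for k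
  have [measurable]: "q \<in> borel_measurable borel"
    using q0 by simp
  have int: "integrable lborel (\<lambda>t. indicator {0..} t *\<^sub>R ?h t)"
  proof (rule Bochner_Integration.integrable_bound[where f = "\<lambda>t. 2 * q t"])
    show "AE t in lborel. norm (indicator {0..} t *\<^sub>R ?h t) \<le> norm (2 * q t)"
      by (intro AE_I2) (auto simp: indicator_def abs_mult mult_left_le_one_le)
  qed (use q0 in auto)
  have "filterlim T at_top sequentially"
    unfolding T_def using s
    by (intro filterlim_tendsto_pos_mult_at_top[OF tendsto_const] filterlim_real_sequentially) simp
  with tendsto_integral_at_top[OF sets_lborel int]
  have "(\<lambda>k. LINT t|lborel. indicator {..T k} t *\<^sub>R indicator {0..} t *\<^sub>R ?h t)
      \<longlonglongrightarrow> (LINT t|lborel. indicator {0..} t *\<^sub>R ?h t)"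
    by (rule filterlim_compose)
  moreover have "(LINT t|lborel. indicator {..T k} t *\<^sub>R indicator {0..} t *\<^sub>R ?h t)
      = (LINT t:{0..T k}|lborel. ?h t)" for k
    unfolding set_lebesgue_integral_def
    by (intro Bochner_Integration.integral_cong refl) (auto simp: indicator_def)
  moreover have "(LINT t|lborel. indicator {0..} t *\<^sub>R ?h t) = qtilde q l"
    by (simp add: qtilde_def set_lebesgue_integral_def s_def)
  ultimately have lim: "(\<lambda>k. LINT t:{0..T k}|lborel. ?h t) \<longlonglongrightarrow> qtilde q l"
    by simp
  have bound: "\<bar>LINT t:{0..T k}|lborel. ?h t\<bar> \<le> ?C" for k
    using truncated_cosine_transform_bound[OF q q' q'' s(1), of "T k"] s
    by (simp add: T_def sin_npi2)
  show ?thesis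
    by (rule LIMSEQ_le_const2[OF tendsto_rabs[OF lim]]) (use bound in blast)
qed


context wave_speed
begin

lemma source_sq_integrable:
  fixes q q' q'' :: "real \<Rightarrow> real"
  assumes q0: "integrable lborel q"
    and q: "\<And>t. (q has_real_derivative q' t) (at t)"
    and q': "\<And>t. (q' has_real_derivative q'' t) (at t)"
    and q'': "continuous_on UNIV q''" "integrable lborel q''"
    and nonneg: "\<And>s. 0 \<le> qtilde q (s\<^sup>2)"
  shows "sq_integrable M (source v xmax q)"
proof -
  obtain C where C: "\<And>l. 0 < l \<Longrightarrow> \<bar>qtilde q l\<bar> \<le> C / l"
    using qtilde_decay[OF q0 q q' q''] by blast
  let ?c = "\<lambda>l. sqrt (qtilde q l) * dirac_wip v (ef l)"
  have "(\<lambda>l. (C * (1 / (v 0)\<^sup>2)\<^sup>2) * ((ef l 0)\<^sup>2 / l)) summable_on spec"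
    by (rule summable_on_cmult_right[OF summable_ef_at_0])
  then have "(\<lambda>l. (?c l)\<^sup>2) summable_on spec"
  proof (rule summable_on_comparison_test)
    fix l assume "l \<in> spec"
    then have l: "0 < l" by (rule spec_pos)
    have "0 \<le> qtilde q l"
      using nonneg[of "sqrt l"] l by simp
    then have "(?c l)\<^sup>2 = qtilde q l * ((ef l 0)\<^sup>2 * (1 / (v 0)\<^sup>2)\<^sup>2)"
      by (simp add: dirac_wip_def dirac_right_def power_mult_distrib power_divide)
    also have "\<dots> \<le> C / l * ((ef l 0)\<^sup>2 * (1 / (v 0)\<^sup>2)\<^sup>2)"
      using C[OF l] by (intro mult_right_mono) auto
    finally show "(?c l)\<^sup>2 \<le> (C * (1 / (v 0)\<^sup>2)\<^sup>2) * ((ef l 0)\<^sup>2 / l)"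
      by (simp add: mult_ac)
  qed simp
  then have "sq_integrable M (fun_of_A v xmax (\<lambda>l. sqrt (qtilde q l)) (dirac_wip v))"
    using fun_of_A_expands[where z = "dirac_wip v"] by (simp add: expands_def)
  then show ?thesis
    unfolding source_def by (rule sq_integrable_cmult)
qed

end

section \<open>Inner products of snapshots\<close>

context wave_speed
begin

lemma Parseval_wip:
  assumes "expands M spec ef c u" "expands M spec ef d w"
  shows "((\<lambda>l. c l * d l) has_sum wip v xmax u w) spec"
proof -
  have "wip v xmax u w = ip M u w"
    using assms by (intro wip_eq_ip) (simp_all add: expands_def sq_integrable_measurable)
  then show ?thesis
    using Parseval_identity[OF ef_orthonormal assms] by simp
qed

lemma snapshot_expands:
  assumes "sq_integrable M (source v xmax q)"
  shows "expands M spec ef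
    (\<lambda>l. cos (real k * \<tau> * sqrt l) * wip v xmax (source v xmax q) (ef l)) (snapshot v xmax q \<tau> k)"
  unfolding snapshot_def by (rule op_of_A_expands) (simp_all add: assms)

lemma propagator_expands:
  assumes "expands M spec ef c u"
  shows "expands M spec ef (\<lambda>l. cos (\<tau> * sqrt l) * c l) (propagator v xmax \<tau> u)"
proof -
  have u: "sq_integrable M u"
    using assms by (simp add: expands_def)
  have "expands M spec ef (\<lambda>l. cos (\<tau> * sqrt l) * wip v xmax u (ef l)) (propagator v xmax \<tau> u)"
    unfolding propagator_def by (rule op_of_A_expands) (simp_all add: u)
  moreover have "wip v xmax u (ef l) = c l" if "l \<in> spec" for l
  proof -
    have "wip v xmax u (ef l) = ip M u (ef l)"
      by (intro wip_eq_ip sq_integrable_measurable u ef_sq_integrable that)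
    then show ?thesis
      using expands_coefficient[OF ef_orthonormal assms that] by simp
  qed
  ultimately show ?thesis
    using expands_cong[of spec "\<lambda>l. cos (\<tau> * sqrt l) * wip v xmax u (ef l)" "\<lambda>l. cos (\<tau> * sqrt l) * c l" M ef]
    by simp
qed

text \<open>
  The integer index is what makes the product formulas below uniform in the sign of \<open>i - j\<close> and of
  \<open>i + j - 1\<close>.
\<close>

lemma data_has_sum:
  assumes "sq_integrable M (source v xmax q)"
  shows "((\<lambda>l. (wip v xmax (source v xmax q) (ef l))\<^sup>2 * cos (real_of_int k * (\<tau> * sqrt l)))
    has_sum data v xmax q \<tau> (nat \<bar>k\<bar>)) spec"
proof -
  have cos_abs: "cos (real (nat \<bar>k\<bar>) * \<tau> * s) = cos (real_of_int k * (\<tau> * s))" for s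
    by (cases "0 \<le> k") (simp_all add: mult.assoc)
  then show ?thesis
    using Parseval_wip[OF snapshot_expands[OF assms] snapshot_expands[OF assms],
        of 0 \<tau> "nat \<bar>k\<bar>" \<tau>, unfolded cos_abs]
    by (simp add: data_def power2_eq_square mult_ac)
qed

lemma wip_snapshot_snapshot:
  assumes "sq_integrable M (source v xmax q)"
  shows "wip v xmax (snapshot v xmax q \<tau> i) (snapshot v xmax q \<tau> j)
    = (data v xmax q \<tau> (nat \<bar>int i - int j\<bar>) + data v xmax q \<tau> (nat \<bar>int i + int j\<bar>)) / 2"
proof -
  let ?b = "\<lambda>l. wip v xmax (source v xmax q) (ef l)" and ?t = "\<lambda>l. \<tau> * sqrt l"
  let ?f = "\<lambda>k l. (?b l)\<^sup>2 * cos (real_of_int k * ?t l)"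
  have eq: "cos (real i * x) * b * (cos (real j * x) * b)
      = (b\<^sup>2 * cos (real_of_int (int i - int j) * x) + b\<^sup>2 * cos (real_of_int (int i + int j) * x)) * (1 / 2)"
    for b x :: real
    by (simp add: cos_add cos_diff algebra_simps power2_eq_square)
  have "((\<lambda>l. (?f (int i - int j) l + ?f (int i + int j) l) * (1 / 2)) has_sum
      (data v xmax q \<tau> (nat \<bar>int i - int j\<bar>) + data v xmax q \<tau> (nat \<bar>int i + int j\<bar>)) * (1 / 2)) spec"
    by (intro has_sum_cmult_left has_sum_add data_has_sum assms)
  moreover have "((\<lambda>l. (?f (int i - int j) l + ?f (int i + int j) l) * (1 / 2)) has_sum
      wip v xmax (snapshot v xmax q \<tau> i) (snapshot v xmax q \<tau> j)) spec"
    unfolding eq[symmetric]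
    using Parseval_wip[OF snapshot_expands[OF assms] snapshot_expands[OF assms], of i \<tau> j \<tau>]
    by (simp add: mult.assoc)
  ultimately show ?thesis
    using has_sum_unique by fastforce
qed

lemma wip_snapshot_propagator_snapshot:
  assumes "sq_integrable M (source v xmax q)"
  shows "wip v xmax (snapshot v xmax q \<tau> i) (propagator v xmax \<tau> (snapshot v xmax q \<tau> j))
    = (data v xmax q \<tau> (nat \<bar>int i - int j + 1\<bar>) + data v xmax q \<tau> (nat \<bar>int i - int j - 1\<bar>)
     + data v xmax q \<tau> (nat \<bar>int i + int j + 1\<bar>) + data v xmax q \<tau> (nat \<bar>int i + int j - 1\<bar>)) / 4"
proof -
  let ?b = "\<lambda>l. wip v xmax (source v xmax q) (ef l)" and ?t = "\<lambda>l. \<tau> * sqrt l"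
  let ?f = "\<lambda>k l. (?b l)\<^sup>2 * cos (real_of_int k * ?t l)"
  have eq: "cos (real i * x) * b * (cos x * (cos (real j * x) * b))
      = (b\<^sup>2 * cos (real_of_int (int i - int j + 1) * x) + b\<^sup>2 * cos (real_of_int (int i - int j - 1) * x)
       + b\<^sup>2 * cos (real_of_int (int i + int j + 1) * x) + b\<^sup>2 * cos (real_of_int (int i + int j - 1) * x)) * (1 / 4)"
    for b x :: real
    by (simp add: cos_add cos_diff sin_add sin_diff algebra_simps power2_eq_square)
  have "((\<lambda>l. (?f (int i - int j + 1) l + ?f (int i - int j - 1) l
        + ?f (int i + int j + 1) l + ?f (int i + int j - 1) l) * (1 / 4)) has_sum
      (data v xmax q \<tau> (nat \<bar>int i - int j + 1\<bar>) + data v xmax q \<tau> (nat \<bar>int i - int j - 1\<bar>)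
     + data v xmax q \<tau> (nat \<bar>int i + int j + 1\<bar>) + data v xmax q \<tau> (nat \<bar>int i + int j - 1\<bar>)) * (1 / 4)) spec"
    by (intro has_sum_cmult_left has_sum_add data_has_sum assms)
  moreover have "((\<lambda>l. (?f (int i - int j + 1) l + ?f (int i - int j - 1) l
        + ?f (int i + int j + 1) l + ?f (int i + int j - 1) l) * (1 / 4)) has_sum
      wip v xmax (snapshot v xmax q \<tau> i) (propagator v xmax \<tau> (snapshot v xmax q \<tau> j))) spec"
    unfolding eq[symmetric]
    using Parseval_wip[OF snapshot_expands[OF assms] propagator_expands[OF snapshot_expands[OF assms]],
        of i \<tau> \<tau> j \<tau>]
    by (simp add: mult.assoc)
  ultimately show ?thesis
    using has_sum_unique by fastforce
qed

end

section \<open>The matrices of the data\<close>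

text \<open>
  Seen through the even extension of \<open>f\<close> to the integers, each of the six matrices is given by one
  formula: the entries \<open>f\<^sub>1\<close> in front of \<open>f\<^sub>0\<close> are \<open>f\<close> at \<open>-1\<close>.
\<close>

lemma toeplitz_hankel_entries:
  assumes "i < n" "j < n"
  shows "T0 n f $$ (i, j) = f (nat \<bar>int i - int j\<bar>)"
    and "Tplus n f $$ (i, j) = f (nat \<bar>int i - int j + 1\<bar>)"
    and "Tminus n f $$ (i, j) = f (nat \<bar>int i - int j - 1\<bar>)"
    and "H0 n f $$ (i, j) = f (nat \<bar>int i + int j\<bar>)"
    and "Hplus n f $$ (i, j) = f (nat \<bar>int i + int j + 1\<bar>)"
    and "Hminus n f $$ (i, j) = f (nat \<bar>int i + int j - 1\<bar>)"
proof -
  have 1: "(f (Suc 0) # map f [0..<n - Suc 0]) ! k = f (nat \<bar>int k - 1\<bar>)" if "k < n" for k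
    using that by (cases k) (auto simp: nth_Cons')
  have 2: "map f [a..<b] ! k = f (a + k)" if "a + k < b" for a b k
    using that by simp
  have 3: "map (\<lambda>k. f (nat \<bar>k\<bar>)) [int n - 2..2 * int n - 3] ! k = f (nat \<bar>int n - 2 + int k\<bar>)" if "k < n" for k
    using that by (simp add: nth_upto)
  show "T0 n f $$ (i, j) = f (nat \<bar>int i - int j\<bar>)"
    using assms by (auto simp: T0_def toeplitz_def 2 simp del: upt_Suc intro!: arg_cong[where f = f])
  show "Tplus n f $$ (i, j) = f (nat \<bar>int i - int j + 1\<bar>)"
    using assms by (auto simp: Tplus_def toeplitz_def 1 2 simp del: nth_Cons_Suc upt_Suc intro!: arg_cong[where f = f])
  show "Tminus n f $$ (i, j) = f (nat \<bar>int i - int j - 1\<bar>)"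
    using assms by (auto simp: Tminus_def toeplitz_def 1 2 simp del: nth_Cons_Suc upt_Suc intro!: arg_cong[where f = f])
  show "H0 n f $$ (i, j) = f (nat \<bar>int i + int j\<bar>)"
    using assms by (auto simp: H0_def hankel_def 2 simp del: upt_Suc intro!: arg_cong[where f = f])
  show "Hplus n f $$ (i, j) = f (nat \<bar>int i + int j + 1\<bar>)"
    using assms by (auto simp: Hplus_def hankel_def 2 simp del: upt_Suc intro!: arg_cong[where f = f])
  show "Hminus n f $$ (i, j) = f (nat \<bar>int i + int j - 1\<bar>)"
    using assms by (auto simp: Hminus_def hankel_def 1 2 3 simp del: nth_Cons_Suc upt_Suc intro!: arg_cong[where f = f])
qed

theorem lemma4p4:
  fixes xmax \<tau> :: real and v q q' q'' :: "real \<Rightarrow> real" and n :: nat and f :: "nat \<Rightarrow> real"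
    and U :: "(real \<Rightarrow> real) list"
  assumes "0 < xmax"
    and "continuous_on {0..xmax} v" and "\<And>x. x \<in> {0..xmax} \<Longrightarrow> 0 < v x"
    and "integrable lborel q" and "\<And>t. q (- t) = q t"
    and "\<And>t. (q has_real_derivative q' t) (at t)"
    and "\<And>t. (q' has_real_derivative q'' t) (at t)"
    and "continuous_on UNIV q''" and "integrable lborel q''"
    and "\<And>s. 0 \<le> qtilde q (s\<^sup>2)"
    and "positive_definite_op v xmax (op_of_A v xmax (qtilde q))"
    and "0 < \<tau>" and "1 \<le> n"
    and "f = data v xmax q \<tau>"
    and "U = snapshots v xmax q \<tau> n"
  shows "adj_times v xmax U (map (propagator v xmax \<tau>) U)
           = (1 / 4) \<cdot>\<^sub>m (Tplus n f + Tminus n f + Hplus n f + Hminus n f)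
       \<and> adj_times v xmax U U = (1 / 2) \<cdot>\<^sub>m (T0 n f + H0 n f)"
proof -
  interpret wave_speed v xmax
    using assms(1-3) by unfold_locales
  have b: "sq_integrable M (source v xmax q)"
    by (rule source_sq_integrable[OF assms(4,6-10)])
  have dims: "dim_row (T0 n f) = n" "dim_col (T0 n f) = n" "dim_row (H0 n f) = n" "dim_col (H0 n f) = n"
    "dim_row (Tplus n f) = n" "dim_col (Tplus n f) = n" "dim_row (Tminus n f) = n" "dim_col (Tminus n f) = n"
    "dim_row (Hplus n f) = n" "dim_col (Hplus n f) = n" "dim_row (Hminus n f) = n" "dim_col (Hminus n f) = n"
    by (simp_all add: T0_def H0_def Tplus_def Tminus_def Hplus_def Hminus_def toeplitz_def hankel_def)
  have U: "length U = n" "\<And>i. i < n \<Longrightarrow> U ! i = snapshot v xmax q \<tau> i"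
    by (simp_all add: assms(15) snapshots_def)
  have "adj_times v xmax U (map (propagator v xmax \<tau>) U)
      = (1 / 4) \<cdot>\<^sub>m (Tplus n f + Tminus n f + Hplus n f + Hminus n f)"
    by (rule eq_matI)
       (simp_all add: adj_times_def U dims toeplitz_hankel_entries wip_snapshot_propagator_snapshot[OF b] flip: assms(14))
  moreover have "adj_times v xmax U U = (1 / 2) \<cdot>\<^sub>m (T0 n f + H0 n f)"
    by (rule eq_matI)
       (simp_all add: adj_times_def U dims toeplitz_hankel_entries wip_snapshot_snapshot[OF b] flip: assms(14))
  ultimately show ?thesis ..
qed

end
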